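(* Let $P$ be a convex equal-area $n$-gon, normalized so that $[\mathbf{v}_{i-\frac12},\mathbf{n}_i]=[\mathbf{v}_{i+\frac12},\mathbf{n}_i]=1$ for all $i$, let $A$ be the area of the region bounded by $P$, and let $L=n$ be its affine perimeter. Then $$\sum_{i=1}^n\mu_{i+\frac12}\le\frac{L^2}{2A},$$ with equality if and only if $P$ is affinely regular.
   Context: $[u,v]$ denotes the determinant of two plane vectors. Let $P$ be a polygon with vertices $P_1,\dots,P_n\in\mathbb{R}^2$, $n\ge 5$, all indices taken modulo $n$, and oriented sides $\mathbf{v}_{i+\frac12}=P_{i+1}-P_i$. $P$ is a convex equal-area $n$-gon if it is a simple polygon bounding a convex planar domain, no three consecutive vertices are collinear, and $[\mathbf{v}_{i-\frac12},\mathbf{v}_{i+\frac12}]=[\mathbf{v}_{i+\frac12},\mathbf{v}_{i+\frac32}]$ for every $i$. The affine normal vector at $P_i$ is $\mathbf{n}_i=\mathbf{v}_{i+\frac12}-\mathbf{v}_{i-\frac12}$; the determinants $[\mathbf{v}_{i-\frac12},\mathbf{n}_i]=[\mathbf{v}_{i+\frac12},\mathbf{n}_i]=[\mathbf{v}_{i-\frac12},\mathbf{v}_{i+\frac12}]$ do not depend on $i$, and the normalization (achieved by an affine transformation) makes them equal to $1$. The vector $\mathbf{n}_{i+1}-\mathbf{n}_i$ is parallel to $\mathbf{v}_{i+\frac12}$, and the discrete affine curvature $\mu_{i+\frac12}$ is defined by $\mathbf{n}_{i+1}-\mathbf{n}_i=-\mu_{i+\frac12}\mathbf{v}_{i+\frac12}$.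 With this normalization the affine perimeter is defined to be $L=n$. $P$ is affinely regular if it is the image of a convex regular $n$-gon under an invertible affine transformation. *)

theory Defs
  imports "HOL-Analysis.Analysis"
begin

text \<open>A polygon with n vertices is a map from the integers to the plane with period n, which is the
  encoding of indices taken modulo n. Objects attached to the side joining the vertices i and i + 1,
  which carry the half-integer index i + 1/2, are indexed by i.\<close>

definition plane_det :: "real^2 \<Rightarrow> real^2 \<Rightarrow> real" where
  "plane_det u v = det (vector [u, v] :: real^2^2)"

text \<open>Polygonal arc with the k + 1 sides from P 0 to P (k + 1).\<close>

primrec polygonal_arc :: "(int \<Rightarrow> real^2) \<Rightarrow> nat \<Rightarrow> real \<Rightarrow> real^2" where
  "polygonal_arc P 0 = linepath (P 0) (P 1)"
| "polygonal_arc P (Suc k) = polygonal_arc P k +++ linepath (P (int k + 1)) (P (int k + 2))"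

definition polygon_path :: "nat \<Rightarrow> (int \<Rightarrow> real^2) \<Rightarrow> real \<Rightarrow> real^2" where
  "polygon_path n P = polygonal_arc P (n - 1)"

definition polygon_region :: "nat \<Rightarrow> (int \<Rightarrow> real^2) \<Rightarrow> (real^2) set" where
  "polygon_region n P = inside (path_image (polygon_path n P))"

definition convex_polygon :: "nat \<Rightarrow> (int \<Rightarrow> real^2) \<Rightarrow> bool" where
  "convex_polygon n P \<longleftrightarrow>
     (\<forall>i. P (i + int n) = P i) \<and>
     simple_path (polygon_path n P) \<and>
     convex (polygon_region n P) \<and>
     (\<forall>i. \<not> collinear {P (i - 1), P i, P (i + 1)})"

definition side :: "(int \<Rightarrow> real^2) \<Rightarrow> int \<Rightarrow> real^2" where
  "side P i = P (i + 1) - P i"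

definition convex_equal_area_polygon :: "nat \<Rightarrow> (int \<Rightarrow> real^2) \<Rightarrow> bool" where
  "convex_equal_area_polygon n P \<longleftrightarrow>
     convex_polygon n P \<and>
     (\<forall>i. plane_det (side P (i - 1)) (side P i) = plane_det (side P i) (side P (i + 1)))"

definition affine_normal :: "(int \<Rightarrow> real^2) \<Rightarrow> int \<Rightarrow> real^2" where
  "affine_normal P i = side P i - side P (i - 1)"

definition affine_normalized :: "(int \<Rightarrow> real^2) \<Rightarrow> bool" where
  "affine_normalized P \<longleftrightarrow>
     (\<forall>i. plane_det (side P (i - 1)) (affine_normal P i) = 1 \<and>
          plane_det (side P i) (affine_normal P i) = 1)"

definition affine_curvature :: "(int \<Rightarrow> real^2) \<Rightarrow> int \<Rightarrow> real" where
  "affine_curvature P i =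
     (THE m. affine_normal P (i + 1) - affine_normal P i = - m *\<^sub>R side P i)"

lemma affine_curvature_eq:
  assumes "convex_equal_area_polygon n P"
  shows "affine_normal P (i + 1) - affine_normal P i = - affine_curvature P i *\<^sub>R side P i"
proof -
  define w where "w = affine_normal P (i + 1) - affine_normal P i"
  define v where "v = side P i"
  have w: "w = side P (i + 1) - 2 *\<^sub>R v + side P (i - 1)"
    by (simp add: w_def v_def affine_normal_def algebra_simps scaleR_2)
  have "plane_det (side P (i - 1)) v = plane_det v (side P (i + 1))"
    using assms by (simp add: convex_equal_area_polygon_def v_def)
  then have par: "w $ 1 * v $ 2 = w $ 2 * v $ 1"
    by (simp add: w plane_det_def det_2 algebra_simps)
  have "\<not> collinear {P (i - 1), P i, P (i + 1)}"
    using assms by (simp add: convex_equal_area_polygon_def convex_polygon_def)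
  then have v0: "v \<noteq> 0"
    by (auto simp: v_def side_def)
  have "\<exists>m. w = - m *\<^sub>R v"
  proof (cases "v $ 1 = 0")
    case True
    with v0 have "v $ 2 \<noteq> 0"
      by (auto simp: vec_eq_iff forall_2)
    with par True have "w = - (- (w $ 2 / v $ 2)) *\<^sub>R v"
      by (auto simp: vec_eq_iff forall_2)
    then show ?thesis ..
  next
    case False
    with par have "w = - (- (w $ 1 / v $ 1)) *\<^sub>R v"
      by (auto simp: vec_eq_iff forall_2 field_simps)
    then show ?thesis ..
  qed
  with v0 have "\<exists>!m. w = - m *\<^sub>R v"
    by auto
  then show ?thesis
    unfolding affine_curvature_def w_def v_def by (rule theI')
qed

text \<open>In a convex polygon the interior angle is less than \<open>\<pi>\<close>, so it is the unoriented angle between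
  the two sides at the vertex.\<close>

definition interior_angle :: "(int \<Rightarrow> real^2) \<Rightarrow> int \<Rightarrow> real" where
  "interior_angle P i =
     arccos (((P (i - 1) - P i) \<bullet> (P (i + 1) - P i)) /
             (norm (P (i - 1) - P i) * norm (P (i + 1) - P i)))"

definition convex_regular_polygon :: "nat \<Rightarrow> (int \<Rightarrow> real^2) \<Rightarrow> bool" where
  "convex_regular_polygon n P \<longleftrightarrow>
     convex_polygon n P \<and>
     (\<forall>i j. norm (side P i) = norm (side P j)) \<and>
     (\<forall>i j. interior_angle P i = interior_angle P j)"

definition affinely_regular :: "nat \<Rightarrow> (int \<Rightarrow> real^2) \<Rightarrow> bool" where
  "affinely_regular n P \<longleftrightarrow>
     (\<exists>Q (M :: real^2^2) b.
        convex_regular_polygon n Q \<and> invertible M \<and> (\<forall>i. P i = M *v Q i + b))"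

end

theory Submission
  imports Defs
begin

text \<open>The polygon \<open>N\<close> with vertices \<open>- n i\<close> has sides \<open>\<mu> i v i\<close>, parallel to those of \<open>P\<close>. For the mixed
  area, \<open>A(N, N)\<close> is half the sum of the curvatures and \<open>A(P, N) = n / 2\<close>, so that the claim is
  Minkowski's inequality \<open>A(P, P) A(N, N) \<le> A(P, N)\<^sup>2\<close>, where \<open>N\<close> need not be convex. It holds because
  for each side of \<open>P\<close> there is a \<open>t\<close> with \<open>A(N - t P, N - t P) \<le> 0\<close>: choose \<open>t\<close> such that the vertex
  corresponding to the one of \<open>P\<close> farthest from the side falls on the line of that side. Equality
  forces \<open>\<mu> = t\<close> everywhere, and then the sides of \<open>P\<close> form an orbit of a linear map conjugate to a
  rotation.\<close>

subsection \<open>Minkowski's inequality for polygons with parallel sides\<close>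

lemma plane_det_eq: "plane_det u v = u $ 1 * v $ 2 - u $ 2 * v $ 1"
  by (simp add: plane_det_def det_2)

lemma plane_det_simps:
  "plane_det u u = 0" "plane_det 0 u = 0" "plane_det u 0 = 0"
  "plane_det (u + w) v = plane_det u v + plane_det w v"
  "plane_det v (u + w) = plane_det v u + plane_det v w"
  "plane_det (u - w) v = plane_det u v - plane_det w v"
  "plane_det v (u - w) = plane_det v u - plane_det v w"
  "plane_det (r *\<^sub>R u) v = r * plane_det u v"
  "plane_det u (r *\<^sub>R v) = r * plane_det u v"
  "plane_det (- u) v = - plane_det u v"
  "plane_det u (- v) = - plane_det u v"
  by (simp_all add: plane_det_eq algebra_simps)

lemma plane_det_skew: "plane_det v u = - plane_det u v"
  by (simp add: plane_det_eq)

text \<open>The Grassmann-Pluecker relation for four plane vectors. In the chain sum it turns the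
  change of a boundary coefficient at a vertex into a multiple of the height of that vertex.\<close>

lemma plane_det_pluecker:
  "plane_det x a * plane_det w b - plane_det x b * plane_det w a = plane_det x w * plane_det a b"
  by (simp add: plane_det_eq algebra_simps)

text \<open>Cramer's rule with respect to \<open>a\<close> and \<open>b\<close>, with the
  denominator cleared.\<close>

lemma plane_det_expand:
  "plane_det a b *\<^sub>R x = plane_det x b *\<^sub>R a + plane_det a x *\<^sub>R b"
  by (simp add: plane_det_eq vec_eq_iff forall_2 algebra_simps)

lemma plane_det_parallel:
  assumes "plane_det w x = 0" "w \<noteq> 0"
  obtains t where "x = t *\<^sub>R w"
proof -
  have "x = ((x \<bullet> w) / (w \<bullet> w)) *\<^sub>R w"
  proof -
    have "w \<bullet> w \<noteq> 0" using assms by simp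
    moreover have "(w \<bullet> w) *\<^sub>R x = (x \<bullet> w) *\<^sub>R w"
      using assms(1) by (simp add: vec_eq_iff forall_2 plane_det_eq inner_vec_def sum_2) algebra
    ultimately show ?thesis
      by (metis divide_inverse_commute scaleR_scaleR scaleR_one left_inverse)
  qed
  then show thesis by (rule that)
qed

lemma plane_det_parallel_both:
  assumes "plane_det w x = 0" "plane_det w y = 0" "w \<noteq> 0"
  shows "plane_det x y = 0"
  by (metis assms plane_det_parallel plane_det_simps(1,8,9) mult_zero_right)

text \<open>Summation by parts. The height of \<open>Q i\<close> over the axis along
  \<open>w\<close> is \<open>plane_det w (Q i)\<close>, and each summand is the increment of the
  height times \<open>plane_det (Q i) (v i) / plane_det w (v i)\<close>, the coordinate at which the
  line of side i cuts the axis. By \<open>plane_det_pluecker\<close> this coordinate changes at a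
  vertex in proportion to the height there, which produces the squares. The lower boundary term
  vanishes because the chain starts on the axis.\<close>

lemma sum_plane_det_chain:
  fixes Q v :: "nat \<Rightarrow> real^2" and l :: "nat \<Rightarrow> real"
  assumes step: "\<And>i. i \<le> k \<Longrightarrow> Q (Suc i) = Q i + l i *\<^sub>R v i"
    and up: "\<And>i. i \<le> k \<Longrightarrow> plane_det w (v i) \<noteq> 0"
    and start: "plane_det w (Q 0) = 0"
  shows "(\<Sum>i\<le>k. plane_det (Q i) (Q (Suc i))) =
    plane_det (Q k) (v k) / plane_det w (v k) * plane_det w (Q (Suc k)) -
    (\<Sum>i<k. (plane_det w (Q (Suc i)))\<^sup>2 * plane_det (v i) (v (Suc i)) /
       (plane_det w (v i) * plane_det w (v (Suc i))))"
  using assms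
proof (induction k)
  case 0
  then show ?case by (simp add: plane_det_simps)
next
  case (Suc k)
  define x y a b d where "x = plane_det (Q (Suc k)) (v k)" "y = plane_det w (Q (Suc k))"
    "a = plane_det w (v k)" "b = plane_det w (v (Suc k))" "d = plane_det (v k) (v (Suc k))"
  note defs = this
  define z where "z = plane_det (Q (Suc k)) (v (Suc k))"
  have ab: "a \<noteq> 0" "b \<noteq> 0" using Suc.prems(2) by (auto simp: defs)
  have x: "plane_det (Q k) (v k) = x"
    using Suc.prems(1)[of k] by (simp add: defs plane_det_simps)
  have y: "plane_det w (Q (Suc (Suc k))) = y + l (Suc k) * b"
    using Suc.prems(1)[of "Suc k"] by (simp add: defs plane_det_simps)
  have z: "plane_det (Q (Suc k)) (Q (Suc (Suc k))) = l (Suc k) * z"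
    using Suc.prems(1)[of "Suc k"] by (simp add: z_def plane_det_simps)
  have pl: "x * b - z * a = - y * d"
    using plane_det_pluecker[of "Q (Suc k)" "v k" w "v (Suc k)"] plane_det_skew[of w "Q (Suc k)"]
    by (simp add: defs z_def)
  \<comment> \<open>Advancing the boundary term by one side: replacing the coefficient
    \<open>x / a\<close> by \<open>z / b\<close> at height \<open>y\<close> costs exactly the new
    square.\<close>
  have "x / a * y + l (Suc k) * z = z / b * (y + l (Suc k) * b) - y\<^sup>2 * d / (a * b)"
  proof -
    have "x / a * y - z / b * y = y * (x * b - z * a) / (a * b)"
      using ab by (simp add: field_simps)
    moreover have "y * (x * b - z * a) = - (y\<^sup>2 * d)"
      unfolding pl by (simp add: power2_eq_square)
    moreover have "z / b * (y + l (Suc k) * b) = z / b * y + l (Suc k) * z"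
      using ab by (simp add: field_simps)
    ultimately show ?thesis by simp
  qed
  moreover have IH: "(\<Sum>i\<le>k. plane_det (Q i) (Q (Suc i))) =
      plane_det (Q k) (v k) / plane_det w (v k) * plane_det w (Q (Suc k)) -
      (\<Sum>i<k. (plane_det w (Q (Suc i)))\<^sup>2 * plane_det (v i) (v (Suc i)) /
         (plane_det w (v i) * plane_det w (v (Suc i))))"
    using Suc.prems by (intro Suc.IH) auto
  ultimately show ?case
    by (simp add: IH x y z defs[symmetric] z_def[symmetric])
qed

text \<open>With both ends on the axis, summation by parts has turned the area into minus a sum of squares.\<close>

lemma chain_area_nonpos:
  fixes Q v :: "nat \<Rightarrow> real^2" and l :: "nat \<Rightarrow> real"
  assumes step: "\<And>i. i < k \<Longrightarrow> Q (Suc i) = Q i + l i *\<^sub>R v i"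
    and up: "\<And>i. i < k \<Longrightarrow> plane_det w (v i) > 0"
    and left: "\<And>i. Suc i < k \<Longrightarrow> plane_det (v i) (v (Suc i)) > 0"
    and axis: "plane_det w (Q 0) = 0" "plane_det w (Q k) = 0"
  shows "(\<Sum>i<k. plane_det (Q i) (Q (Suc i))) \<le> 0 \<and>
    ((\<Sum>i<k. plane_det (Q i) (Q (Suc i))) = 0 \<longrightarrow> (\<forall>i<k. l i = 0))"
proof (cases k)
  case 0
  then show ?thesis by simp
next
  case (Suc m)
  let ?e = "\<lambda>i. (plane_det w (Q (Suc i)))\<^sup>2 * plane_det (v i) (v (Suc i)) /
       (plane_det w (v i) * plane_det w (v (Suc i)))"
  have "(\<Sum>i\<le>m. plane_det (Q i) (Q (Suc i))) =
      plane_det (Q m) (v m) / plane_det w (v m) * plane_det w (Q (Suc m)) - sum ?e {..<m}"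
    using step axis up by (intro sum_plane_det_chain) (auto simp: Suc less_Suc_eq_le less_imp_neq[symmetric])
  then have eq: "(\<Sum>i<k. plane_det (Q i) (Q (Suc i))) = - sum ?e {..<m}"
    using axis by (simp add: Suc lessThan_Suc_atMost)
  have nonneg: "?e i \<ge> 0" if "i < m" for i
    using that left[of i] up[of i] up[of "Suc i"] by (simp add: Suc)
  \<comment> \<open>If all squares vanish, every vertex lies on the axis; as each side direction is
    transversal to the axis, every coefficient is 0.\<close>
  have "l i = 0" if "sum ?e {..<m} = 0" "i < k" for i
  proof -
    have "?e j = 0" if "j < m" for j
      using \<open>sum ?e {..<m} = 0\<close> nonneg that by (subst (asm) sum_nonneg_eq_0_iff) auto
    then have "plane_det w (Q (Suc j)) = 0" if "j < m" for j
      using that left[of j] up[of j] up[of "Suc j"] by (fastforce simp: Suc)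
    then have "plane_det w (Q j) = 0" if "j \<le> k" for j
      using that axis by (cases j) (auto simp: Suc le_less)
    from this[of i] this[of "Suc i"] step[of i] up[of i] that show ?thesis
      by (auto simp: plane_det_simps)
  qed
  then show ?thesis
    using sum_nonneg[of "{..<m}" ?e] nonneg unfolding eq by auto
qed

section \<open>Closed polygons: sums over a period, and the inequality for polygons with parallel
  sides\<close>

lemma sum_periodic_shift:
  fixes f :: "int \<Rightarrow> real"
  assumes "\<And>i. f (i + int n) = f i"
  shows "(\<Sum>i = 1..int n. f (i + k)) = (\<Sum>i = 1..int n. f i)"
proof -
  have 1: "(\<Sum>i = 1..int n. g (i + 1)) = (\<Sum>i = 1..int n. g i)"
    if "\<And>i. g (i + int n) = g i" for g :: "int \<Rightarrow> real"
  proof (cases "n = 0")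
    case False
    have "(\<Sum>i = 1..int n. g (i + 1)) = (\<Sum>i = 2..int n + 1. g i)"
      by (rule sum.reindex_bij_witness[of _ "\<lambda>i. i - 1" "\<lambda>i. i + 1"]) auto
    also have "{2..int n + 1} = insert (int n + 1) {2..int n}"
      using False by auto
    also have "sum g \<dots> = g 1 + (\<Sum>i = 2..int n. g i)"
      using that[of 1] by (simp add: add.commute)
    also have "\<dots> = sum g (insert 1 {2..int n})"
      by simp
    also have "insert 1 {2..int n} = {1..int n}"
      using False by auto
    finally show ?thesis .
  qed simp
  show ?thesis
  proof (induction k rule: int_induct[where k = 0])
    case (step1 i)
    then show ?case
      using 1[of "\<lambda>j. f (j + i)"] assms[of "_ + i"] by (simp add: algebra_simps)
  next
    case (step2 i)
    then show ?case
      using 1[of "\<lambda>j. f (j + (i - 1))"] assms[of "_ + (i - 1)"] by (simp add: algebra_simps)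
  qed simp
qed

lemma sum_int_eq_sum_nat:
  fixes f :: "int \<Rightarrow> real"
  assumes "\<And>i. f (i + int n) = f i"
  shows "(\<Sum>i = 1..int n. f i) = (\<Sum>i<n. f (int i))"
proof -
  have "(\<Sum>i = 1..int n. f i) = (\<Sum>i = 1..int n. f (i + - 1))"
    by (rule sum_periodic_shift[symmetric]) (rule assms)
  also have "\<dots> = (\<Sum>i<n. f (int i))"
    by (rule sum.reindex_bij_witness[of _ "\<lambda>i. int i + 1" "\<lambda>i. nat (i - 1)"]) auto
  finally show ?thesis .
qed

text \<open>The terms linear in \<open>z\<close> cancel around a closed polygon, so any point may
  serve as origin.\<close>

lemma closed_area_translate:
  fixes X :: "int \<Rightarrow> real^2"
  assumes "\<And>i. X (i + int n) = X i"
  shows "(\<Sum>i = 1..int n. plane_det (X i - z) (X (i + 1) - z)) =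
    (\<Sum>i = 1..int n. plane_det (X i) (X (i + 1)))"
proof -
  have "plane_det (X i - z) (X (i + 1) - z) =
      plane_det (X i) (X (i + 1)) + plane_det z (X i) - plane_det z (X (i + 1))" for i
    by (simp add: plane_det_eq algebra_simps)
  moreover have "(\<Sum>i = 1..int n. plane_det z (X (i + 1))) = (\<Sum>i = 1..int n. plane_det z (X i))"
    using assms by (intro sum_periodic_shift) simp
  ultimately show ?thesis
    by (simp add: sum.distrib sum_subtractf)
qed

text \<open>The discrete shadow of a normalized convex equal-area polygon: no path and no region
  occur, so the inequality can be proved by finite sums alone. That such a polygon satisfies these
  conditions is shown in the lemma of the same name.\<close>

locale unit_polygon =
  fixes n :: nat and P :: "int \<Rightarrow> real^2"
  assumes n3: "n \<ge> 3"
    and periodic: "P (i + int n) = P i"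
    and det_sides: "plane_det (side P i) (side P (i + 1)) = 1"
    and left: "0 \<le> plane_det (side P i) (P j - P i)"
    and distinct: "P i = P j \<Longrightarrow> int n dvd i - j"
begin

lemma det_sides': "plane_det (side P (i - 1)) (side P i) = 1"
  using det_sides[of "i - 1"] by simp

lemma side_nonzero: "side P i \<noteq> 0"
  using det_sides[of i] by (auto simp: plane_det_simps)

lemma side_periodic: "side P (i + int n) = side P i"
  using periodic[of i] periodic[of "i + 1"] by (simp add: side_def algebra_simps)

lemma vertex_Suc: "P (i + 1) = P i + side P i"
  by (simp add: side_def)

text \<open>A vertex \<open>P j\<close> on the line of side i would lie strictly inside that side,
  since the neighbouring sides confine \<open>t\<close> to [0, 1] and the end points are excluded.
  For each of the two sides at \<open>P j\<close>, both ends of side i lie weakly on its left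
  although \<open>P j\<close> separates them; so both are parallel to side i, against their
  determinant 1.\<close>

lemma strictly_left:
  assumes "\<not> int n dvd j - i" "\<not> int n dvd j - (i + 1)"
  shows "0 < plane_det (side P i) (P j - P i)"
proof (rule ccontr)
  assume "\<not> ?thesis"
  with left[of i j] have "plane_det (side P i) (P j - P i) = 0" by simp
  then obtain t where t: "P j - P i = t *\<^sub>R side P i"
    using side_nonzero plane_det_parallel by blast
  have Pj: "P j = P i + t *\<^sub>R side P i" using t by (simp add: algebra_simps)
  have "t \<noteq> 0" "t \<noteq> 1"
    using assms distinct[of j i] distinct[of j "i + 1"] by (auto simp: Pj vertex_Suc)
  moreover have "t \<ge> 0"
    using left[of "i - 1" j] det_sides'[of i] vertex_Suc[of "i - 1"]
    by (simp add: Pj plane_det_simps)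
  moreover have "t \<le> 1"
    using left[of "i + 1" j] det_sides[of i] plane_det_skew[of "side P (i + 1)" "side P i"]
    by (simp add: Pj vertex_Suc plane_det_simps)
  ultimately have t01: "0 < t" "t < 1" by auto
  have flat: "plane_det (side P k) (side P i) = 0"
    if "0 \<le> plane_det (side P k) (P i - P j)" "0 \<le> plane_det (side P k) (P (i + 1) - P j)" for k
  proof -
    have "P i - P j = - t *\<^sub>R side P i" "P (i + 1) - P j = (1 - t) *\<^sub>R side P i"
      by (simp_all add: Pj vertex_Suc scaleR_left_diff_distrib)
    then have "0 \<le> - t * plane_det (side P k) (side P i)" "0 \<le> (1 - t) * plane_det (side P k) (side P i)"
      using that by (simp_all only: plane_det_simps)
    with t01 show ?thesis
      by (simp add: zero_le_mult_iff mult_le_0_iff)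
  qed
  have "plane_det (side P j) (side P i) = 0"
    by (rule flat; rule left)
  moreover have "plane_det (side P (j - 1)) (side P i) = 0"
    using left[of "j - 1" i] left[of "j - 1" "i + 1"] vertex_Suc[of "j - 1"]
    by (intro flat) (auto simp: plane_det_simps)
  ultimately have "plane_det (side P (j - 1)) (side P j) = 0"
    using side_nonzero[of i] plane_det_parallel_both plane_det_skew
    by (metis neg_equal_0_iff_equal)
  with det_sides'[of j] show False by simp
qed

lemma height_pos:
  assumes "2 \<le> j" "j < int n"
  shows "0 < plane_det (side P 0) (P j - P 0)"
  using assms zdvd_imp_le[of "int n" j] zdvd_imp_le[of "int n" "j - 1"]
  by (intro strictly_left) auto

text \<open>The heights over the side 0 have no local minimum off this side: convexity would put all vertices
  above it, the end points of the side included.\<close>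

lemma highest_vertex:
  obtains m where "2 \<le> m" "m < n"
    "\<And>i. \<lbrakk>1 \<le> i; i < m\<rbrakk> \<Longrightarrow> plane_det (side P 0) (side P (int i)) > 0"
    "plane_det (side P 0) (side P (int m)) \<le> 0"
    "\<And>i. \<lbrakk>m < i; i < n\<rbrakk> \<Longrightarrow> plane_det (side P 0) (side P (int i)) < 0"
proof -
  let ?u = "\<lambda>i::nat. plane_det (side P 0) (side P (int i))"
  let ?M = "\<lambda>i. 1 \<le> i \<and> ?u i \<le> 0"
  have u1: "?u 1 = 1" using det_sides[of 0] by simp
  \<comment> \<open>The last side leads back to vertex 0; its index is congruent to - 1, and it
    descends.\<close>
  have "side P (int (n - 1)) = side P (- 1)"
    using side_periodic[of "- 1"] n3 by (simp add: of_nat_diff algebra_simps)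
  then have ul: "?u (n - 1) = - 1"
    using det_sides[of "- 1"] plane_det_skew[of "side P 0" "side P (- 1)"] by simp
  \<comment> \<open>The first side that does not rise; it may be parallel to side 0.\<close>
  define m where "m = (LEAST i. ?M i)"
  have Mn: "?M (n - 1)" using ul n3 by simp
  then have Mm: "?M m" unfolding m_def by (rule LeastI)
  have mn: "m \<le> n - 1" unfolding m_def using Mn by (rule Least_le)
  have lt: "?u i > 0" if "1 \<le> i" "i < m" for i
    using not_less_Least[of i ?M] that by (fastforce simp: m_def)
  have m2: "2 \<le> m"
    using Mm u1 by (cases "m = 1") auto
  \<comment> \<open>After a side that does not rise the next one falls. Otherwise
    \<open>P (i + 1)\<close> would be a local minimum, and \<open>P 0\<close>, which lies in the
    cone from it towards its two neighbours, would be at least as high, against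
    \<open>height_pos\<close>.\<close>
  have gt: "?u (Suc i) < 0" if "m \<le> i" "Suc i < n" "?u i \<le> 0" for i
  proof (rule ccontr)
    assume "\<not> ?thesis"
    then have ui: "?u (Suc i) \<ge> 0" by simp
    let ?a = "side P (int i)" and ?b = "side P (int i + 1)"
    let ?x = "P 0 - P (int i + 1)"
    have d: "plane_det ?a ?b = 1" by (rule det_sides)
    have a: "plane_det ?a ?x \<ge> 0"
      using left[of "int i" 0] by (simp add: vertex_Suc plane_det_simps)
    have b: "plane_det ?b ?x \<ge> 0"
      by (rule left)
    define c e where "c = plane_det ?x ?b" and "e = plane_det ?a ?x"
    have x: "?x = c *\<^sub>R ?a + e *\<^sub>R ?b"
      using plane_det_expand[of ?a ?b ?x] d by (simp add: c_def e_def)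
    have "plane_det (side P 0) ?x = c * ?u i + e * plane_det (side P 0) ?b"
      unfolding x by (simp add: plane_det_simps)
    also have "\<dots> = c * ?u i + e * ?u (Suc i)"
      by (simp add: add.commute)
    also have "\<dots> = plane_det ?b ?x * (- ?u i) + plane_det ?a ?x * ?u (Suc i)"
      using plane_det_skew[of ?x ?b] by (simp add: c_def e_def)
    also have "\<dots> \<ge> 0"
      using a b ui that by (intro add_nonneg_nonneg mult_nonneg_nonneg) auto
    finally have "0 \<le> plane_det (side P 0) ?x" .
    moreover have "0 < plane_det (side P 0) (P (int i + 1) - P 0)"
      using that m2 by (intro height_pos) auto
    ultimately show False by (simp add: plane_det_simps)
  qed
  have desc: "?u i < 0" if "m < i" "i < n" for i
    using that
  proof (induction i)
    case (Suc i)
    then show ?case using gt[of i] Mm by (cases "i = m") auto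
  qed simp
  show thesis
    by (rule that[OF m2 _ lt _ desc]) (use mn n3 Mm in auto)
qed

lemma shift: "unit_polygon n (\<lambda>i. P (i + k))"
proof -
  have s: "side (\<lambda>i. P (i + k)) i = side P (i + k)" for i
    by (simp add: side_def algebra_simps)
  show ?thesis
  proof
    fix i j
    show "P (i + int n + k) = P (i + k)" using periodic[of "i + k"] by (simp add: algebra_simps)
    show "plane_det (side (\<lambda>i. P (i + k)) i) (side (\<lambda>i. P (i + k)) (i + 1)) = 1"
      using det_sides[of "i + k"] by (simp add: s algebra_simps)
    show "0 \<le> plane_det (side (\<lambda>i. P (i + k)) i) (P (j + k) - P (i + k))"
      unfolding s by (rule left)
    show "int n dvd i - j" if "P (i + k) = P (j + k)"
      using distinct[OF that] by simp
  qed (rule n3)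
qed

text \<open>Subtracting t times P from Q brings the vertex m to the line of the side 0; both chains
  between that side and the vertex m then start and end on this line.\<close>

lemma minkowski_base:
  assumes Q: "\<And>i. Q (i + 1) = Q i + l i *\<^sub>R side P i" and Qper: "\<And>i. Q (i + int n) = Q i"
  shows "\<exists>t. (\<Sum>i = 1..int n. plane_det (Q i - t *\<^sub>R P i) (Q (i + 1) - t *\<^sub>R P (i + 1))) \<le> 0 \<and>
    ((\<Sum>i = 1..int n. plane_det (Q i - t *\<^sub>R P i) (Q (i + 1) - t *\<^sub>R P (i + 1))) = 0 \<longrightarrow> l 1 = t)"
proof -
  obtain m where m: "2 \<le> m" "m < n"
    and up: "\<And>i. \<lbrakk>1 \<le> i; i < m\<rbrakk> \<Longrightarrow> plane_det (side P 0) (side P (int i)) > 0"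
    and top: "plane_det (side P 0) (side P (int m)) \<le> 0"
    and down: "\<And>i. \<lbrakk>m < i; i < n\<rbrakk> \<Longrightarrow> plane_det (side P 0) (side P (int i)) < 0"
    using highest_vertex by blast
  let ?w = "side P 0"
  \<comment> \<open>The quotient of the heights of the vertex m over the vertex 0 in Q and in P, so
    that in \<open>Q - t P\<close> both have the same height.\<close>
  define t where "t = plane_det ?w (Q (int m) - Q 0) / plane_det ?w (P (int m) - P 0)"
  \<comment> \<open>Translating vertex 0 to the origin makes the axis along \<open>?w\<close> the
    line of side 0; by \<open>closed_area_translate\<close> the area does not change.\<close>
  define Z where "Z = Q 0 - t *\<^sub>R P 0"
  define X where "X = (\<lambda>i. Q i - t *\<^sub>R P i - Z)"
  define g where "g = (\<lambda>i. plane_det (X i) (X (i + 1)))"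
  have hm: "plane_det ?w (P (int m) - P 0) > 0"
    using m by (intro height_pos) auto
  have X_Suc: "X (i + 1) = X i + (l i - t) *\<^sub>R side P i" for i
    using Q[of i] vertex_Suc[of i] by (simp add: X_def algebra_simps)
  have X_per: "X (i + int n) = X i" for i
    by (simp add: X_def Qper periodic)
  have X0: "X 0 = 0" by (simp add: X_def Z_def)
  have Xm: "plane_det ?w (X (int m)) = 0"
  proof -
    have "plane_det ?w (X (int m)) =
        plane_det ?w (Q (int m) - Q 0) - t * plane_det ?w (P (int m) - P 0)"
      by (simp add: X_def Z_def plane_det_simps algebra_simps)
    then show ?thesis using hm by (simp add: t_def)
  qed
  have X1: "plane_det ?w (X 1) = 0"
    using X_Suc[of 0] by (simp add: X0 plane_det_simps)
  have Xn: "X (int n) = 0" using X_per[of 0] X0 by simp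
  have "(\<Sum>i = 1..int n. plane_det (Q i - t *\<^sub>R P i) (Q (i + 1) - t *\<^sub>R P (i + 1))) =
      (\<Sum>i = 1..int n. g i)"
    unfolding g_def X_def by (rule closed_area_translate[symmetric]) (simp add: Qper periodic)
  also have "\<dots> = (\<Sum>i<n. g (int i))"
  proof (rule sum_int_eq_sum_nat)
    fix i
    show "g (i + int n) = g i"
      using X_per[of i] X_per[of "i + 1"] by (simp add: g_def algebra_simps)
  qed
  \<comment> \<open>Side 0 contributes nothing as \<open>X 0 = 0\<close>; the other sides split into
    the rising chain and the rest.\<close>
  also have "{..<n} = insert 0 ({1..<m} \<union> {m..<n})"
    using m by auto
  also have "(\<Sum>i\<in>\<dots>. g (int i)) = (\<Sum>i = 1..<m. g (int i)) + (\<Sum>i = m..<n. g (int i))"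
    using m by (subst sum.insert) (auto simp: sum.union_disjoint g_def X0 plane_det_simps)
  finally have split: "(\<Sum>i = 1..int n. plane_det (Q i - t *\<^sub>R P i) (Q (i + 1) - t *\<^sub>R P (i + 1))) =
      (\<Sum>i = 1..<m. g (int i)) + (\<Sum>i = m..<n. g (int i))" .
  have first: "(\<Sum>i = 1..<m. g (int i)) \<le> 0 \<and>
      ((\<Sum>i = 1..<m. g (int i)) = 0 \<longrightarrow> (\<forall>i<m - 1. l (int i + 1) - t = 0))"
  proof -
    have "(\<Sum>i = 1..<m. g (int i)) =
        (\<Sum>i<m - 1. plane_det (X (int i + 1)) (X (int (Suc i) + 1)))"
      by (rule sum.reindex_bij_witness[of _ Suc "\<lambda>i. i - 1"])
        (auto simp: g_def of_nat_diff algebra_simps)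
    also have "\<dots> \<le> 0 \<and> (\<dots> = 0 \<longrightarrow> (\<forall>i<m - 1. l (int i + 1) - t = 0))"
    proof (rule chain_area_nonpos)
      fix i
      show "X (int (Suc i) + 1) = X (int i + 1) + (l (int i + 1) - t) *\<^sub>R side P (int i + 1)"
        using X_Suc[of "int i + 1"] by (simp add: add.commute)
      show "plane_det ?w (side P (int i + 1)) > 0" if "i < m - 1"
        using up[of "Suc i"] that by (simp add: add.commute)
      show "plane_det (side P (int i + 1)) (side P (int (Suc i) + 1)) > 0"
        using det_sides[of "int i + 1"] by (simp add: add.commute)
    qed (use X1 Xm m in \<open>auto simp: of_nat_diff\<close>)
    finally show ?thesis .
  qed
  have second: "(\<Sum>i = m..<n. g (int i)) \<le> 0"
  proof -
    \<comment> \<open>If side m is parallel to side 0, it lies on the axis and adds no area; the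
      chain of strictly falling sides then starts one vertex later.\<close>
    define m' where "m' = (if plane_det ?w (side P (int m)) = 0 then m + 1 else m)"
    have m': "m' \<le> n" "m \<le> m'" using m by (auto simp: m'_def)
    have Xm': "plane_det ?w (X (int m')) = 0"
      using Xm X_Suc[of "int m"] by (simp add: m'_def plane_det_simps add.commute)
    have neg: "plane_det ?w (side P (int i)) < 0" if "m' \<le> i" "i < n" for i
      using that top down[of i] by (cases "i = m") (auto simp: m'_def split: if_splits)
    have "(\<Sum>i = m..<m'. g (int i)) = 0"
    proof (intro sum.neutral ballI)
      fix i assume "i \<in> {m..<m'}"
      then have "i = m" "m' = m + 1" by (auto simp: m'_def split: if_splits)
      then show "g (int i) = 0"
        using plane_det_parallel_both[OF Xm Xm' side_nonzero] by (simp add: g_def add.commute)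
    qed
    moreover have "(\<Sum>i = m..<n. g (int i)) = (\<Sum>i = m..<m'. g (int i)) + (\<Sum>i = m'..<n. g (int i))"
      using m' by (intro sum.atLeastLessThan_concat[symmetric]) auto
    moreover have "(\<Sum>i = m'..<n. g (int i)) =
        (\<Sum>i<n - m'. plane_det (X (int i + int m')) (X (int (Suc i) + int m')))"
      by (rule sum.reindex_bij_witness[of _ "\<lambda>i. i + m'" "\<lambda>i. i - m'"])
        (auto simp: g_def of_nat_diff algebra_simps)
    \<comment> \<open>The falling chain rises over the reversed axis \<open>- ?w\<close>.\<close>
    moreover have "\<dots> \<le> 0 \<and> (\<dots> = 0 \<longrightarrow> (\<forall>i<n - m'. l (int i + int m') - t = 0))"
    proof (rule chain_area_nonpos)
      fix i
      show "X (int (Suc i) + int m') =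
          X (int i + int m') + (l (int i + int m') - t) *\<^sub>R side P (int i + int m')"
        using X_Suc[of "int i + int m'"] by (simp add: ac_simps)
      show "plane_det (- ?w) (side P (int i + int m')) > 0" if "i < n - m'"
        using neg[of "i + m'"] that by (simp add: plane_det_simps)
      show "plane_det (side P (int i + int m')) (side P (int (Suc i) + int m')) > 0"
        using det_sides[of "int i + int m'"] by (simp add: ac_simps)
    qed (use Xm' Xn m' in \<open>auto simp: of_nat_diff plane_det_simps\<close>)
    ultimately show ?thesis by simp
  qed
  \<comment> \<open>Both chain areas are nonpositive, so a zero total makes that of the rising chain
    vanish; this chain starts with side 1, as \<open>m\<close> is at least 2.\<close>
  have "l 1 = t" if "(\<Sum>i = 1..<m. g (int i)) + (\<Sum>i = m..<n. g (int i)) = 0"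
  proof -
    have "(\<Sum>i = 1..<m. g (int i)) = 0" using that first second by linarith
    then have "\<forall>i<m - 1. l (int i + 1) - t = 0" using first by blast
    from this[rule_format, of 0] m show ?thesis by simp
  qed
  then show ?thesis
    using first second unfolding split[symmetric] by (intro exI[of _ t]) (simp add: split)
qed

text \<open>Rotating the indices by \<open>k - 1\<close> moves side k to index 1, the index at which
  \<open>minkowski_base\<close> identifies the coefficient.\<close>

lemma minkowski_shift:
  assumes Q: "\<And>i. Q (i + 1) = Q i + l i *\<^sub>R side P i" and Qper: "\<And>i. Q (i + int n) = Q i"
  shows "\<exists>t. (\<Sum>i = 1..int n. plane_det (Q i - t *\<^sub>R P i) (Q (i + 1) - t *\<^sub>R P (i + 1))) \<le> 0 \<and>
    ((\<Sum>i = 1..int n. plane_det (Q i - t *\<^sub>R P i) (Q (i + 1) - t *\<^sub>R P (i + 1))) = 0 \<longrightarrow> l k = t)"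
proof -
  interpret S: unit_polygon n "\<lambda>i. P (i + (k - 1))" by (rule shift)
  have 1: "Q (i + 1 + (k - 1)) =
      Q (i + (k - 1)) + l (i + (k - 1)) *\<^sub>R side (\<lambda>i. P (i + (k - 1))) i" for i
    using Q[of "i + (k - 1)"] by (simp add: side_def algebra_simps)
  have 2: "Q (i + int n + (k - 1)) = Q (i + (k - 1))" for i
    using Qper[of "i + (k - 1)"] by (simp add: algebra_simps)
  let ?f = "\<lambda>t i. plane_det (Q i - t *\<^sub>R P i) (Q (i + 1) - t *\<^sub>R P (i + 1))"
  have "(\<Sum>i = 1..int n. ?f t (i + (k - 1))) = (\<Sum>i = 1..int n. ?f t i)" for t
  proof (rule sum_periodic_shift)
    fix i
    show "?f t (i + int n) = ?f t i"
      using Qper[of i] Qper[of "i + 1"] periodic[of i] periodic[of "i + 1"]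
      by (simp add: algebra_simps)
  qed
  then show ?thesis
    using S.minkowski_base[of "\<lambda>i. Q (i + (k - 1))" "\<lambda>i. l (i + (k - 1))", OF 1 2]
    by (simp add: algebra_simps)
qed

end

subsection \<open>Geometry of a convex polygonal region\<close>

lemma connected_component_linear_image:
  fixes f :: "'a::euclidean_space \<Rightarrow> 'b::euclidean_space"
  assumes "linear f" "inj f" "connected_component (- S) x y"
  shows "connected_component (- (f ` S)) (f x) (f y)"
proof -
  obtain T where T: "connected T" "T \<subseteq> - S" "x \<in> T" "y \<in> T"
    using assms by (auto simp: connected_component_def)
  have "connected (f ` T)"
    using T assms by (intro connected_continuous_image linear_continuous_on) (simp add: linear_conv_bounded_linear)
  moreover have "f ` T \<subseteq> - (f ` S)"
    using T(2) \<open>inj f\<close> by (auto simp: inj_eq)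
  ultimately show ?thesis
    unfolding connected_component_def using T by blast
qed

text \<open>A linear isomorphism carries the components of the complement to components and
  preserves their boundedness.\<close>

lemma inside_linear_image:
  fixes f :: "'a::euclidean_space \<Rightarrow> 'b::euclidean_space"
  assumes f: "linear f" and g: "linear g" and gf: "\<And>x. g (f x) = x" and fg: "\<And>y. f (g y) = y"
  shows "inside (f ` S) = f ` inside S"
proof -
  have inj: "inj f" "inj g" by (metis gf injI) (metis fg injI)
  have gS: "g ` f ` S = S" by (simp add: image_image gf)
  have eq: "connected_component_set (- (f ` S)) (f x) = f ` connected_component_set (- S) x" for x
  proof (intro set_eqI iffI)
    fix y assume "y \<in> connected_component_set (- (f ` S)) (f x)"
    then have "connected_component (- S) x (g y)"
      using connected_component_linear_image[OF g inj(2), of "f ` S" "f x" y] by (simp add: gS gf)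
    then have "f (g y) \<in> f ` connected_component_set (- S) x" by blast
    then show "y \<in> f ` connected_component_set (- S) x" by (simp add: fg)
  next
    fix y assume "y \<in> f ` connected_component_set (- S) x"
    then show "y \<in> connected_component_set (- (f ` S)) (f x)"
      using connected_component_linear_image[OF f inj(1)] by auto
  qed
  have bounded: "bounded (f ` C) \<longleftrightarrow> bounded C" for C
  proof
    assume "bounded (f ` C)"
    then have "bounded (g ` f ` C)"
      using g by (simp add: bounded_linear_image linear_conv_bounded_linear)
    then show "bounded C" by (simp add: image_image gf)
  qed (use f in \<open>simp add: bounded_linear_image linear_conv_bounded_linear\<close>)
  have iff: "f x \<in> inside (f ` S) \<longleftrightarrow> x \<in> inside S" for x
    using inj(1) by (simp add: inside_def eq bounded inj_image_mem_iff)
  show ?thesis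
  proof (intro set_eqI iffI)
    fix y assume "y \<in> inside (f ` S)"
    then have "g y \<in> inside S" using iff[of "g y"] by (simp add: fg)
    then show "y \<in> f ` inside S" using fg[of y] by (metis imageI)
  qed (use iff in auto)
qed

text \<open>The Jordan curve theorem of the complex plane, transported along a linear
  isomorphism.\<close>

lemma Jordan_inside_plane:
  fixes c :: "real \<Rightarrow> real^2"
  assumes "simple_path c" "pathfinish c = pathstart c"
  shows "inside (path_image c) \<noteq> {}" "open (inside (path_image c))"
    "frontier (inside (path_image c)) = path_image c"
proof -
  obtain f :: "real^2 \<Rightarrow> complex" and g where f: "linear f" and g: "linear g"
    and gf: "\<And>x. g (f x) = x" and fg: "\<And>y. f (g y) = y"
  proof (rule isomorphisms_UNIV_UNIV)
    show "DIM(real^2) = DIM(complex)" by simp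
  qed blast
  have bij: "bij f" using gf fg by (metis bijI')
  then have inj: "inj f" by (rule bij_is_inj)
  define R where "R = inside (path_image c)"
  have R: "inside (f ` path_image c) = f ` R"
    unfolding R_def by (rule inside_linear_image[OF f g gf fg])
  have "simple_path (f \<circ> c)" "pathfinish (f \<circ> c) = pathstart (f \<circ> c)"
    using assms by (simp_all add: simple_path_linear_image_eq[OF f inj] pathfinish_def pathstart_def)
  from Jordan_inside_outside[OF this]
  have J: "f ` R \<noteq> {}" "open (f ` R)" "frontier (f ` R) = f ` path_image c"
    by (simp_all add: R path_image_linear_image[OF f])
  have "frontier (f ` R) = f ` frontier R"
    using inj bij f unfolding frontier_def
    by (simp add: closure_injective_linear_image interior_bijective_linear_image image_set_diff)
  then have "frontier R = path_image c"
    using J(3) inj by (simp add: inj_image_eq_iff)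
  moreover have "open R"
  proof -
    have "g ` f ` R = R" by (simp add: image_image gf)
    moreover have "surj g" by (metis gf surjI)
    ultimately show ?thesis
      using open_surjective_linear_image[OF J(2) g] by simp
  qed
  ultimately show "inside (path_image c) \<noteq> {}" "open (inside (path_image c))"
      "frontier (inside (path_image c)) = path_image c"
    using J(1) by (auto simp: R_def)
qed

section \<open>Polygonal arcs and periodic indexing\<close>

lemma pathstart_polygonal_arc: "pathstart (polygonal_arc P k) = P 0"
  by (induction k) simp_all

lemma pathfinish_polygonal_arc: "pathfinish (polygonal_arc P k) = P (int k + 1)"
  by (cases k) (simp_all add: add.commute)

lemma path_image_polygonal_arc:
  "path_image (polygonal_arc P k) = (\<Union>i\<le>k. closed_segment (P (int i)) (P (int i + 1)))"
proof (induction k)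
  case (Suc k)
  have "path_image (polygonal_arc P (Suc k)) =
      path_image (polygonal_arc P k) \<union> closed_segment (P (int k + 1)) (P (int k + 2))"
    by (simp add: path_image_join pathfinish_polygonal_arc)
  then show ?case
    by (simp add: Suc.IH atMost_Suc Un_commute add.commute)
qed simp

text \<open>The last segment of an arc meets the preceding part only in its starting point, and all
  earlier vertices lie on that part; so the final vertex is new.\<close>

lemma arc_polygonal_arc_inj:
  assumes "arc (polygonal_arc P k)"
  shows "inj_on (\<lambda>i. P (int i)) {..Suc k}"
  using assms
proof (induction k)
  case 0
  then show ?case using arc_distinct_ends[OF 0] by (auto simp: inj_on_def atMost_Suc)
next
  case (Suc k)
  let ?g = "polygonal_arc P k" and ?h = "linepath (P (int k + 1)) (P (int k + 2))"
  have a: "arc ?g" "arc ?h" "path_image ?g \<inter> path_image ?h \<subseteq> {P (int k + 1)}"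
    using Suc.prems by (auto simp: arc_join_eq pathfinish_polygonal_arc)
  have ne: "P (int k + 2) \<noteq> P (int k + 1)"
    using arc_distinct_ends[OF a(2)] by auto
  have mem: "P (int i) \<in> path_image ?g" if "i \<le> Suc k" for i
  proof (cases "i = Suc k")
    case True
    then show ?thesis
      using pathfinish_in_path_image[of ?g] by (simp add: pathfinish_polygonal_arc add.commute)
  next
    case False
    then show ?thesis using that by (auto simp: path_image_polygonal_arc intro!: bexI[of _ i])
  qed
  have "P (int k + 2) \<notin> path_image ?g"
    using a(3) ne by auto
  then have "P (int (Suc (Suc k))) \<notin> (\<lambda>i. P (int i)) ` {..Suc k}"
    using mem by (auto simp: add.commute)
  then show ?case
    using Suc.IH[OF a(1)] by (subst atMost_Suc) (simp add: inj_on_insert del: of_nat_Suc)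
qed

lemma periodic_add_mult:
  fixes f :: "int \<Rightarrow> 'a"
  assumes "\<And>i. f (i + m) = f i"
  shows "f (i + k * m) = f i"
proof (induction k rule: int_induct[where k = 0])
  case (step1 k)
  then show ?case using assms[of "i + k * m"] by (simp add: algebra_simps)
next
  case (step2 k)
  then show ?case using assms[of "i + (k - 1) * m"] by (simp add: algebra_simps)
qed simp

lemma periodic_mod:
  fixes f :: "int \<Rightarrow> 'a"
  assumes "\<And>i. f (i + m) = f i"
  shows "f (i mod m) = f i"
  using periodic_add_mult[of f m "i mod m" "i div m", OF assms] by (simp add: add.commute)

section \<open>The convex region bounded by the polygon, and its area\<close>

context
  fixes n :: nat and P :: "int \<Rightarrow> real^2"
  assumes n3: "n \<ge> 3" and convex: "convex_polygon n P"
    and det1: "\<And>i. plane_det (side P i) (side P (i + 1)) = 1"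
begin

lemma polygon_periodic: "P (i + int n) = P i"
  using convex by (simp add: convex_polygon_def)

lemma polygon_simple_closed:
  "simple_path (polygon_path n P)" "pathfinish (polygon_path n P) = pathstart (polygon_path n P)"
  using convex polygon_periodic[of 0] n3
  by (simp_all add: convex_polygon_def polygon_path_def pathstart_polygonal_arc
      pathfinish_polygonal_arc of_nat_diff)

lemma polygon_region_convex: "convex (polygon_region n P)"
  using convex by (simp add: convex_polygon_def)

lemma polygon_region_open: "open (polygon_region n P)"
  and polygon_region_nonempty: "polygon_region n P \<noteq> {}"
  and frontier_polygon_region: "frontier (polygon_region n P) = path_image (polygon_path n P)"
  using Jordan_inside_plane[OF polygon_simple_closed] by (auto simp: polygon_region_def)

lemma bounded_polygon_region: "bounded (polygon_region n P)"
  unfolding polygon_region_def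
  by (intro bounded_inside bounded_simple_path_image polygon_simple_closed)

text \<open>The path runs through the sides 0 to \<open>n - 1\<close>; by periodicity side 0 is side
  n, which gives the index range of the sums.\<close>

lemma polygon_path_image:
  "path_image (polygon_path n P) = (\<Union>i\<in>{1..int n}. closed_segment (P i) (P (i + 1)))"
proof -
  let ?s = "\<lambda>i. closed_segment (P i) (P (i + 1))"
  have per: "?s (i + int n) = ?s i" for i
    using polygon_periodic[of i] polygon_periodic[of "i + 1"] by (simp add: algebra_simps)
  have "(\<Union>i\<le>n - 1. ?s (int i)) = (\<Union>i\<in>{1..int n}. ?s i)"
  proof (intro equalityI UN_least)
    fix i assume i: "i \<in> {..n - 1}"
    show "?s (int i) \<subseteq> (\<Union>i\<in>{1..int n}. ?s i)"
    proof (cases "i = 0")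
      case True
      then have "?s (int i) = ?s (int n)" using per[of 0] by simp
      moreover have "int n \<in> {1..int n}" using n3 by simp
      ultimately show ?thesis by blast
    next
      case False
      then have "int i \<in> {1..int n}" using i by auto
      then show ?thesis by blast
    qed
  next
    fix i assume i: "i \<in> {1..int n}"
    show "?s i \<subseteq> (\<Union>i\<le>n - 1. ?s (int i))"
    proof (cases "i = int n")
      case True
      then have "?s i = ?s (int 0)" using per[of 0] by simp
      then show ?thesis by blast
    next
      case False
      then have "i = int (nat i)" "nat i \<in> {..n - 1}" using i by auto
      then show ?thesis by (metis (no_types, lifting) UN_upper)
    qed
  qed
  then show ?thesis
    by (simp add: polygon_path_def path_image_polygonal_arc)
qed

lemma side_subset_frontier: "closed_segment (P i) (P (i + 1)) \<subseteq> frontier (polygon_region n P)"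
proof -
  let ?s = "\<lambda>i. closed_segment (P i) (P (i + 1))"
  have per: "?s (i + int n) = ?s i" for i
    using polygon_periodic[of i] polygon_periodic[of "i + 1"] by (simp add: algebra_simps)
  \<comment> \<open>The representative of i modulo n in the range from 1 to n.\<close>
  define j where "j = (i - 1) mod int n + 1"
  have "0 \<le> (i - 1) mod int n" "(i - 1) mod int n < int n" using n3 by simp_all
  then have "j \<in> {1..int n}" by (simp add: j_def)
  moreover have "?s j = ?s i"
  proof -
    have "?s ((i - 1) mod int n + 1) = ?s (i - 1 + 1)"
    proof (rule periodic_mod)
      fix k
      show "?s (k + int n + 1) = ?s (k + 1)"
        using per[of "k + 1"] by (simp add: algebra_simps)
    qed
    then show ?thesis by (simp add: j_def)
  qed
  ultimately show ?thesis
    unfolding frontier_polygon_region polygon_path_image by blast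
qed

lemma vertex_in_closure: "P i \<in> closure (polygon_region n P)"
  using side_subset_frontier[of i] by (auto simp: frontier_def)

text \<open>The supporting line of the convex region at the midpoint of a side contains this side, and the
  region lies to its left because the next vertex does.\<close>

lemma region_left_of_side:
  "x \<in> closure (polygon_region n P) \<Longrightarrow> 0 \<le> plane_det (side P i) (x - P i)"
  "x \<in> polygon_region n P \<Longrightarrow> 0 < plane_det (side P i) (x - P i)"
proof -
  let ?R = "polygon_region n P"
  define z where "z = midpoint (P i) (P (i + 1))"
  have "z \<in> frontier ?R"
    using side_subset_frontier[of i] by (auto simp: z_def)
  then have z: "z \<in> closure ?R" "z \<notin> rel_interior ?R"
    using polygon_region_open by (auto simp: frontier_def interior_open rel_interior_open)
  obtain a where a: "a \<noteq> 0" "\<And>y. y \<in> closure ?R \<Longrightarrow> a \<bullet> z \<le> a \<bullet> y"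
      "\<And>y. y \<in> rel_interior ?R \<Longrightarrow> a \<bullet> z < a \<bullet> y"
    using supporting_hyperplane_relative_frontier[OF polygon_region_convex z] by blast
  have az: "a \<bullet> z = (a \<bullet> P i + a \<bullet> P (i + 1)) / 2"
    by (simp add: z_def midpoint_def inner_add_right)
  \<comment> \<open>The point \<open>z\<close> minimizes the functional on the closure and is the
    mean of the two ends of the side, so both ends attain the minimum as well.\<close>
  have perp: "a \<bullet> P i = a \<bullet> z" "a \<bullet> side P i = 0"
    using a(2)[OF vertex_in_closure[of i]] a(2)[OF vertex_in_closure[of "i + 1"]] az
    by (auto simp: side_def inner_diff_right)
  \<comment> \<open>The vector \<open>a\<close> turned by a right angle, which makes the inner
    product with \<open>a\<close> a determinant and \<open>w\<close> a direction of the supporting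
    line.\<close>
  define w where "w = (vector [a $ 2, - (a $ 1)] :: real^2)"
  have w: "plane_det w y = a \<bullet> y" for y
    by (simp add: w_def plane_det_eq inner_vec_def sum_2)
  have "w \<noteq> 0" using a(1) by (auto simp: w_def vec_eq_iff forall_2)
  then obtain t where t: "side P i = t *\<^sub>R w"
    using plane_det_parallel[of w "side P i"] w perp(2) by metis
  have "a \<bullet> z \<le> a \<bullet> P (i + 2)" by (intro a vertex_in_closure)
  moreover have "P (i + 2) - P i = side P i + side P (i + 1)"
    by (simp add: side_def add.commute)
  ultimately have "0 \<le> plane_det w (side P i + side P (i + 1))"
    using perp(1) by (metis w inner_diff_right diff_ge_0_iff_ge)
  moreover have "plane_det w (side P i) = 0" using w perp(2) by simp
  ultimately have "0 \<le> plane_det w (side P (i + 1))" by (simp add: plane_det_simps)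
  moreover have "t * plane_det w (side P (i + 1)) = 1"
    using det1[of i] by (simp add: t plane_det_simps)
  ultimately have "t > 0"
    by (metis mult_nonpos_nonneg not_less zero_less_one)
  have eq: "plane_det (side P i) (x - P i) = t * (a \<bullet> x - a \<bullet> z)" for x
    using perp(1) by (simp add: t plane_det_simps(8) w inner_diff_right)
  show "x \<in> closure ?R \<Longrightarrow> 0 \<le> plane_det (side P i) (x - P i)"
    unfolding eq using a(2)[of x] \<open>t > 0\<close> by simp
  show "x \<in> ?R \<Longrightarrow> 0 < plane_det (side P i) (x - P i)"
    unfolding eq using a(3)[of x] \<open>t > 0\<close> polygon_region_open by (simp add: rel_interior_open)
qed

text \<open>Removing the closing side from the simple closed path leaves an arc through the vertices
  0 to \<open>n - 1\<close>, to which \<open>arc_polygonal_arc_inj\<close> applies; all other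
  indices reduce to these modulo n.\<close>

lemma polygon_vertices_distinct:
  assumes "P i = P j"
  shows "int n dvd i - j"
proof -
  obtain k where k: "n = Suc (Suc k)"
    using n3 that[of "n - 2"] by simp
  have "polygon_path n P = polygonal_arc P k +++ linepath (P (int k + 1)) (P (int k + 2))"
    by (simp add: polygon_path_def k)
  then have "simple_path (polygonal_arc P k +++ linepath (P (int k + 1)) (P (int k + 2)))"
    using polygon_simple_closed(1) by simp
  then have "arc (polygonal_arc P k)"
    by (rule simple_path_joinE) (simp add: pathfinish_polygonal_arc)
  then have inj: "inj_on (\<lambda>i. P (int i)) {..Suc k}"
    by (rule arc_polygonal_arc_inj)
  have P: "P (int (nat (l mod int n))) = P l" for l
    using periodic_mod[of P "int n" l] polygon_periodic n3 by simp
  have mem: "nat (l mod int n) \<in> {..Suc k}" for l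
  proof -
    have "l mod int n < int n" using n3 by (intro pos_mod_bound) simp
    then have "l mod int n \<le> int (Suc k)" using k by linarith
    then show ?thesis by (simp only: atMost_iff nat_le_iff)
  qed
  have "P (int (nat (i mod int n))) = P (int (nat (j mod int n)))"
    unfolding P by (rule assms)
  then have "nat (i mod int n) = nat (j mod int n)"
    by (rule inj_onD[OF inj _ mem mem])
  moreover have "0 \<le> i mod int n" "0 \<le> j mod int n"
    using n3 by (auto intro: pos_mod_sign)
  ultimately have "i mod int n = j mod int n"
    by linarith
  then show ?thesis by (simp add: mod_eq_dvd_iff)
qed

lemma unit_polygon: "unit_polygon n P"
  by standard (auto intro: n3 polygon_periodic det1 polygon_vertices_distinct
      region_left_of_side(1) vertex_in_closure)

text \<open>The region is the union of the triangles over the sides with apex at an inner point c, along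
  rays from c; on two different triangles the supporting lines force a common point to a segment
  from c to a vertex.\<close>

lemma twice_polygon_area:
  "2 * measure lebesgue (polygon_region n P) = (\<Sum>i = 1..int n. plane_det (P i) (P (i + 1)))"
  "0 < measure lebesgue (polygon_region n P)"
proof -
  interpret unit_polygon n P by (rule unit_polygon)
  let ?R = "polygon_region n P"
  obtain c where c: "c \<in> ?R" using polygon_region_nonempty by blast
  define T where "T = (\<lambda>i. convex hull {c, P i, P (i + 1)})"
  \<comment> \<open>By \<open>pT\<close> this is twice the area of the triangle \<open>T i\<close>;
    it is positive because c is an inner point.\<close>
  define p where "p = (\<lambda>i. plane_det (side P i) (c - P i))"
  have p: "p i > 0" for i unfolding p_def by (rule region_left_of_side(2)[OF c])
  have compactT: "compact (T i)" for i
    unfolding T_def by (intro compact_convex_hull finite_imp_compact) simp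
  have triangle: "measure lebesgue (convex hull {c, A, B}) = \<bar>plane_det (A - c) (B - c)\<bar> / 2" for A B
  proof -
    have "convex hull {c, A, B} \<in> sets lborel"
      using compact_convex_hull[OF finite_imp_compact[of "{c, A, B}"]]
      by (simp add: borel_compact)
    then have "measure lebesgue (convex hull {c, A, B}) = measure lborel (convex hull {c, A, B})"
      by (rule measure_completion)
    also have "\<dots> = \<bar>plane_det (A - c) (B - c)\<bar> / 2"
      unfolding content_triangle by (simp add: plane_det_eq abs_minus_commute algebra_simps)
    finally show ?thesis .
  qed
  have pT: "plane_det (P i - c) (P (i + 1) - c) = p i" for i
    by (simp add: p_def side_def plane_det_eq algebra_simps)
  have areaT: "measure lebesgue (T i) = p i / 2" for i
    unfolding T_def triangle pT using p[of i] by simp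
  have closed: "closure ?R = (\<Union>i\<in>{1..int n}. T i)"
  proof
    have "compact (\<Union>i\<in>{1..int n}. T i)"
      by (intro compact_UN compactT) simp
    moreover have "?R \<subseteq> (\<Union>i\<in>{1..int n}. T i)"
    proof
      fix x assume x: "x \<in> ?R"
      show "x \<in> (\<Union>i\<in>{1..int n}. T i)"
      proof (cases "x = c")
        case True
        then have "x \<in> T 1" by (simp add: T_def hull_inc)
        then show ?thesis using n3 by (intro UN_I[of 1]) auto
      next
        case False
        have int: "interior ?R = ?R" using polygon_region_open by (simp add: interior_open)
        have "\<exists>d>0. c + d *\<^sub>R (x - c) \<in> frontier ?R"
          by (rule ray_to_frontier[of ?R c "x - c"])
            (use bounded_polygon_region c int False in auto)
        then obtain d where d: "0 < d" "c + d *\<^sub>R (x - c) \<in> frontier ?R" by blast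
        \<comment> \<open>The ray meets the frontier only beyond x, since the open convex region
          contains the segment from c to x.\<close>
        have "d > 1"
        proof (rule ccontr)
          assume "\<not> d > 1"
          then have "(1 - d) *\<^sub>R c + d *\<^sub>R x \<in> ?R"
            using d(1) by (intro convexD[OF polygon_region_convex c x]) auto
          then have "c + d *\<^sub>R (x - c) \<in> ?R" by (simp add: algebra_simps)
          then show False using d(2) int by (simp add: frontier_def)
        qed
        obtain i where i: "i \<in> {1..int n}" "c + d *\<^sub>R (x - c) \<in> closed_segment (P i) (P (i + 1))"
          using d(2) unfolding frontier_polygon_region polygon_path_image by blast
        have sub: "closed_segment (P i) (P (i + 1)) \<subseteq> T i"
          unfolding T_def segment_convex_hull by (rule hull_mono) auto
        have "(1 - 1 / d) *\<^sub>R c + (1 / d) *\<^sub>R (c + d *\<^sub>R (x - c)) \<in> T i"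
          using \<open>d > 1\<close> i(2) sub unfolding T_def
          by (intro convexD[OF convex_convex_hull]) (auto simp: hull_inc)
        moreover have "(1 - 1 / d) *\<^sub>R c + (1 / d) *\<^sub>R (c + d *\<^sub>R (x - c)) = x"
          using d(1) by (simp add: algebra_simps)
        ultimately show ?thesis using i(1) by auto
      qed
    qed
    ultimately show "closure ?R \<subseteq> (\<Union>i\<in>{1..int n}. T i)"
      by (meson closure_minimal compact_imp_closed)
    have "c \<in> closure ?R" using c closure_subset by blast
    then show "(\<Union>i\<in>{1..int n}. T i) \<subseteq> closure ?R"
      unfolding T_def
      by (intro UN_least hull_minimal) (auto simp: vertex_in_closure convex_closure polygon_region_convex)
  qed
  \<comment> \<open>A segment is a degenerate triangle with a repeated vertex, hence of area
    0.\<close>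
  have negligible_segment: "negligible (closed_segment c A)" for A
  proof -
    have "convex hull {c, A, A} = closed_segment c A" by (simp add: segment_convex_hull)
    then have "measure lebesgue (closed_segment c A) = 0"
      using triangle[of A A] by (simp add: plane_det_simps)
    then show ?thesis
      by (simp add: negligible_iff_measure lmeasurable_compact)
  qed
  have memT: "\<exists>u v. 0 \<le> u \<and> 0 \<le> v \<and> u + v \<le> 1 \<and> x - c = u *\<^sub>R (P i - c) + v *\<^sub>R (P (i + 1) - c)"
    if "x \<in> T i" for x i
    using that unfolding T_def convex_hull_3_alt by fastforce
  \<comment> \<open>The determinant of \<open>side P i\<close> with \<open>P k - c\<close> is
    \<open>- p i\<close> at the two ends of side i and at least that at every other vertex. So a
    vector has its smallest coefficient sum in terms of the ends of side i, and a tie puts every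
    vertex with nonzero weight on the line of side i.\<close>
  have weight: "u + v \<le> u' + v' \<and>
      (u + v = u' + v' \<longrightarrow> (u' = 0 \<or> plane_det (side P i) (P j - P i) = 0) \<and>
         (v' = 0 \<or> plane_det (side P i) (P (j + 1) - P i) = 0))"
    if "0 \<le> u'" "0 \<le> v'"
      and x: "u *\<^sub>R (P i - c) + v *\<^sub>R (P (i + 1) - c) = u' *\<^sub>R (P j - c) + v' *\<^sub>R (P (j + 1) - c)"
    for i j u v u' v'
  proof -
    let ?d = "\<lambda>k. plane_det (side P i) (P k - P i)"
    have d: "plane_det (side P i) (P k - c) = ?d k - p i" for k
      by (simp add: p_def plane_det_simps)
    have d0: "?d i = 0" "?d (i + 1) = 0"
      by (simp_all add: vertex_Suc plane_det_simps)
    have "u * (?d i - p i) + v * (?d (i + 1) - p i) = u' * (?d j - p i) + v' * (?d (j + 1) - p i)"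
      using arg_cong[OF x, of "plane_det (side P i)"] by (simp only: plane_det_simps(5,9) d)
    then have eq: "(u' + v' - (u + v)) * p i = u' * ?d j + v' * ?d (j + 1)"
      unfolding d0 by (simp add: algebra_simps)
    have nn: "0 \<le> u' * ?d j" "0 \<le> v' * ?d (j + 1)"
      using that left by auto
    have "0 \<le> (u' + v' - (u + v)) * p i" unfolding eq using nn by simp
    then have "u + v \<le> u' + v'" using p[of i] by (simp add: zero_le_mult_iff)
    moreover have "u' * ?d j = 0 \<and> v' * ?d (j + 1) = 0" if "u + v = u' + v'"
    proof -
      have "u' * ?d j + v' * ?d (j + 1) = 0" using eq that by simp
      with nn show ?thesis by linarith
    qed
    ultimately show ?thesis by simp
  qed
  have overlap: "T i \<inter> T j \<subseteq> closed_segment c (P j) \<union> closed_segment c (P (j + 1))"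
    if ij: "i \<in> {1..int n}" "j \<in> {1..int n}" "i \<noteq> j" for i j
  proof
    fix x assume "x \<in> T i \<inter> T j"
    then obtain u v u' v' where
      uv: "0 \<le> u" "0 \<le> v" "x - c = u *\<^sub>R (P i - c) + v *\<^sub>R (P (i + 1) - c)" and
      uv': "0 \<le> u'" "0 \<le> v'" "u' + v' \<le> 1" "x - c = u' *\<^sub>R (P j - c) + v' *\<^sub>R (P (j + 1) - c)"
      using memT[of x i] memT[of x j] by blast
    \<comment> \<open>This is \<open>weight\<close> with i and j exchanged; together with the other
      direction it gives a tie.\<close>
    have "u' + v' \<le> u + v"
      using weight[of u v u' j v' i] uv uv' by simp
    then have "u' = 0 \<or> plane_det (side P i) (P j - P i) = 0"
        "v' = 0 \<or> plane_det (side P i) (P (j + 1) - P i) = 0"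
      using weight[of u' v' u i v j] uv uv' by auto
    \<comment> \<open>By \<open>strictly_left\<close>, both ends of side j would have indices
      congruent to i or i + 1. As i and j are not congruent, j would be congruent to i + 1 and j + 1
      to i, so n would divide 2.\<close>
    moreover have False
      if z: "plane_det (side P i) (P j - P i) = 0" "plane_det (side P i) (P (j + 1) - P i) = 0"
    proof -
      have "int n dvd j - i \<or> int n dvd j - (i + 1)" "int n dvd j + 1 - i \<or> int n dvd j + 1 - (i + 1)"
        using strictly_left[of j i] strictly_left[of "j + 1" i] z by auto
      moreover have "\<not> int n dvd j - i"
        using ij dvd_imp_le_int[of "j - i" "int n"] by auto
      ultimately have "int n dvd j - (i + 1)" "int n dvd j + 1 - i" by auto
      then have "int n dvd (j + 1 - i) - (j - (i + 1))" by (rule dvd_diff[rotated])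
      then have "int n dvd 2" by simp
      then show False using n3 zdvd_imp_le[of "int n" 2] by simp
    qed
    ultimately have "u' = 0 \<or> v' = 0" by blast
    then show "x \<in> closed_segment c (P j) \<union> closed_segment c (P (j + 1))"
    proof
      assume "u' = 0"
      then have "x = (1 - v') *\<^sub>R c + v' *\<^sub>R P (j + 1)"
        using uv'(4) by (simp add: algebra_simps)
      then show ?thesis using uv' \<open>u' = 0\<close> by (auto simp: in_segment)
    next
      assume "v' = 0"
      then have "x = (1 - u') *\<^sub>R c + u' *\<^sub>R P j"
        using uv'(4) by (simp add: algebra_simps)
      then show ?thesis using uv' \<open>v' = 0\<close> by (auto simp: in_segment)
    qed
  qed
  have "negligible (T i \<inter> T j)" if "i \<in> {1..int n}" "j \<in> {1..int n}" "i \<noteq> j" for i j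
    using overlap[OF that] negligible_segment by (meson negligible_Un negligible_subset)
  then have "measure lebesgue (\<Union>i\<in>{1..int n}. T i) = (\<Sum>i = 1..int n. measure lebesgue (T i))"
    by (intro measure_negligible_finite_Union_image) (auto simp: pairwise_def compactT lmeasurable_compact)
  moreover have "measure lebesgue (closure ?R) = measure lebesgue ?R"
    by (intro measure_closure bounded_polygon_region negligible_convex_frontier polygon_region_convex)
  ultimately have area: "2 * measure lebesgue ?R = (\<Sum>i = 1..int n. p i)"
    unfolding closed areaT by (simp add: sum_distrib_left)
  also have "\<dots> = (\<Sum>i = 1..int n. plane_det (P i) (P (i + 1)))"
    unfolding pT[symmetric] by (rule closed_area_translate) (rule polygon_periodic)
  finally show "2 * measure lebesgue ?R = (\<Sum>i = 1..int n. plane_det (P i) (P (i + 1)))" .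
  have "0 < (\<Sum>i = 1..int n. p i)"
    using n3 p by (intro sum_pos) auto
  then show "0 < measure lebesgue ?R" using area by simp
qed

end

subsection \<open>Curvature and affine regularity\<close>

lemma collinear_linear_image:
  assumes "linear f" "collinear S"
  shows "collinear (f ` S)"
proof -
  obtain u where u: "\<And>x y. x \<in> S \<Longrightarrow> y \<in> S \<Longrightarrow> \<exists>c. x - y = c *\<^sub>R u"
    using assms(2) unfolding collinear_def by blast
  have "\<exists>c. f x - f y = c *\<^sub>R f u" if "x \<in> S" "y \<in> S" for x y
    using u[OF that] by (metis assms(1) linear_diff linear_scale)
  then show ?thesis unfolding collinear_def by blast
qed

lemma polygonal_arc_linear_image:
  assumes "linear f"
  shows "polygonal_arc (f \<circ> P) k = f \<circ> polygonal_arc P k"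
proof -
  have "linepath (f a) (f b) = f \<circ> linepath a b" for a b
    using assms by (simp add: fun_eq_iff linepath_def linear_add linear_scale)
  then show ?thesis
    by (induction k) (simp_all add: path_compose_join)
qed

lemma convex_polygon_linear_image:
  assumes f: "linear f" and g: "linear g" and gf: "\<And>x. g (f x) = x" and fg: "\<And>y. f (g y) = y"
    and P: "convex_polygon n P"
  shows "convex_polygon n (f \<circ> P)"
proof -
  have inj: "inj f" by (metis gf injI)
  have path: "polygon_path n (f \<circ> P) = f \<circ> polygon_path n P"
    by (simp add: polygon_path_def polygonal_arc_linear_image[OF f])
  have "\<not> collinear {f (P (i - 1)), f (P i), f (P (i + 1))}" for i
    using collinear_linear_image[OF g, of "{f (P (i - 1)), f (P i), f (P (i + 1))}"] P
    by (auto simp: gf convex_polygon_def)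
  moreover have "polygon_region n (f \<circ> P) = f ` polygon_region n P"
    unfolding polygon_region_def path path_image_linear_image[OF f]
    by (rule inside_linear_image[OF f g gf fg])
  ultimately show ?thesis
    using P f inj by (simp add: convex_polygon_def path simple_path_linear_image_eq convex_linear_image)
qed

section \<open>The polygon of normals, the curvature sum and the case of equality\<close>

context
  fixes n :: nat and P :: "int \<Rightarrow> real^2"
  assumes n3: "n \<ge> 3" and equal_area: "convex_equal_area_polygon n P"
    and normalized: "affine_normalized P"
begin

abbreviation "area2 \<equiv> 2 * measure lebesgue (polygon_region n P)"

lemma equal_area_convex: "convex_polygon n P"
  using equal_area by (simp add: convex_equal_area_polygon_def)

lemma normal_det:
  "plane_det (side P i) (affine_normal P i) = 1"
  "plane_det (side P i) (affine_normal P (i + 1)) = 1"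
  using normalized[unfolded affine_normalized_def, rule_format, of i]
    normalized[unfolded affine_normalized_def, rule_format, of "i + 1"] by auto

lemma side_det: "plane_det (side P i) (side P (i + 1)) = 1"
  using normal_det(2)[of i] by (simp add: affine_normal_def plane_det_simps)

interpretation unit_polygon n P
  by (rule unit_polygon[OF n3 equal_area_convex side_det])

lemma area2_eq: "area2 = (\<Sum>i = 1..int n. plane_det (P i) (P (i + 1)))"
  and area2_pos: "area2 > 0"
  using twice_polygon_area[OF n3 equal_area_convex side_det] by simp_all

lemma normal_Suc:
  "affine_normal P (i + 1) = affine_normal P i - affine_curvature P i *\<^sub>R side P i"
  using affine_curvature_eq[OF equal_area, of i] by (simp add: algebra_simps)

text \<open>A discrete Hill equation for the sides, from which both directions between constant
  curvature and affine regularity are read off.\<close>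

lemma side_Suc: "side P (i + 1) = (2 - affine_curvature P i) *\<^sub>R side P i - side P (i - 1)"
  using normal_Suc[of i] by (simp add: affine_normal_def algebra_simps scaleR_2)

lemma normal_periodic: "affine_normal P (i + int n) = affine_normal P i"
  using side_periodic[of i] side_periodic[of "i - 1"] by (simp add: affine_normal_def algebra_simps)

text \<open>Bilinear expansion. In the mixed terms the determinants of normal and vertex telescope
  around the polygon, and the normalization leaves - 2 for each side.\<close>

lemma sum_normal_combination:
  "(\<Sum>i = 1..int n. plane_det (- affine_normal P i - t *\<^sub>R P i) (- affine_normal P (i + 1) - t *\<^sub>R P (i + 1)))
     = (\<Sum>i = 1..int n. affine_curvature P i) - 2 * t * n + t\<^sup>2 * area2"
proof -
  let ?N = "affine_normal P" and ?g = "\<lambda>i. plane_det (affine_normal P i) (P i)"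
  have nn: "plane_det (?N i) (?N (i + 1)) = affine_curvature P i" for i
    using normal_det(1)[of i] plane_det_skew[of "?N i" "side P i"]
    by (simp add: normal_Suc plane_det_simps)
  have np: "plane_det (?N i) (P (i + 1)) = ?g i - 1" for i
    using normal_det(1)[of i] plane_det_skew[of "?N i" "side P i"]
    by (simp add: vertex_Suc plane_det_simps)
  have pn: "plane_det (P i) (?N (i + 1)) = - ?g (i + 1) - 1" for i
  proof -
    have "P i = P (i + 1) - side P i" by (simp add: vertex_Suc)
    then have "plane_det (P i) (?N (i + 1)) = plane_det (P (i + 1)) (?N (i + 1)) - 1"
      using normal_det(2)[of i] by (metis plane_det_simps(6))
    then show ?thesis using plane_det_skew[of "P (i + 1)" "?N (i + 1)"] by simp
  qed
  have "plane_det (- ?N i - t *\<^sub>R P i) (- ?N (i + 1) - t *\<^sub>R P (i + 1)) =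
      plane_det (?N i) (?N (i + 1)) + t * (plane_det (?N i) (P (i + 1)) + plane_det (P i) (?N (i + 1)))
      + t\<^sup>2 * plane_det (P i) (P (i + 1))" for i
    by (simp only: plane_det_simps) (simp add: algebra_simps power2_eq_square)
  then have summand: "plane_det (- ?N i - t *\<^sub>R P i) (- ?N (i + 1) - t *\<^sub>R P (i + 1)) =
      affine_curvature P i + (t * ?g i - t * ?g (i + 1)) - 2 * t + t\<^sup>2 * plane_det (P i) (P (i + 1))" for i
    unfolding nn np pn by (simp add: right_diff_distrib distrib_left)
  have "(\<Sum>i = 1..int n. t * ?g (i + 1)) = (\<Sum>i = 1..int n. t * ?g i)"
    by (rule sum_periodic_shift) (simp add: normal_periodic periodic)
  then show ?thesis
    unfolding summand area2_eq by (simp add: sum.distrib sum_subtractf sum_distrib_left)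
qed

text \<open>The quadratic polynomial of \<open>sum_normal_combination\<close> has a nonpositive
  value at some t, whereas its minimum, at \<open>n / area2\<close>, is the curvature sum minus
  \<open>n\<^sup>2 / area2\<close>. If this minimum is 0, then t is the double root, and
  \<open>minkowski_shift\<close> gives the curvature of side k.\<close>

lemma curvature_sum_le:
  "(\<Sum>i = 1..int n. affine_curvature P i) \<le> n\<^sup>2 / area2"
  "(\<Sum>i = 1..int n. affine_curvature P i) = n\<^sup>2 / area2 \<Longrightarrow> affine_curvature P k = n / area2"
proof -
  let ?s = "\<Sum>i = 1..int n. affine_curvature P i"
  have "\<exists>t::real. ?s - 2 * t * n + t\<^sup>2 * area2 \<le> 0 \<and>
      (?s - 2 * t * n + t\<^sup>2 * area2 = 0 \<longrightarrow> affine_curvature P k = t)"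
    using minkowski_shift[of "\<lambda>i. - affine_normal P i" "affine_curvature P" k]
    unfolding sum_normal_combination by (simp add: normal_Suc normal_periodic)
  then obtain t :: real where t: "?s - 2 * t * n + t\<^sup>2 * area2 \<le> 0"
      "?s - 2 * t * n + t\<^sup>2 * area2 = 0 \<Longrightarrow> affine_curvature P k = t" by blast
  have square: "?s - 2 * t * n + t\<^sup>2 * area2 = ?s - n\<^sup>2 / area2 + area2 * (t - n / area2)\<^sup>2"
    using area2_pos by (simp add: power2_eq_square field_simps)
  have nonneg: "0 \<le> area2 * (t - n / area2)\<^sup>2"
    using area2_pos by (intro mult_nonneg_nonneg) auto
  show "?s \<le> n\<^sup>2 / area2" using t(1) nonneg unfolding square by linarith
  assume eq: "?s = n\<^sup>2 / area2"
  then have z: "area2 * (t - n / area2)\<^sup>2 = 0" using t(1) nonneg unfolding square by linarith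
  then have "t = n / area2" using area2_pos by auto
  moreover have "affine_curvature P k = t" using t(2) z eq unfolding square by simp
  ultimately show "affine_curvature P k = n / area2" by simp
qed

text \<open>For constant curvature m the polygon with vertices
  \<open>- affine_normal P i - m *\<^sub>R P i\<close> shrinks to a point, so m is a root of the
  quadratic polynomial, whose constant term is now \<open>m * n\<close>.\<close>

lemma curvature_sum_constant:
  assumes "\<And>i. affine_curvature P i = m"
  shows "(\<Sum>i = 1..int n. affine_curvature P i) = n\<^sup>2 / area2"
proof -
  have "- affine_normal P (i + 1) - m *\<^sub>R P (i + 1) = - affine_normal P i - m *\<^sub>R P i" for i
    by (simp only: normal_Suc assms vertex_Suc) (simp add: algebra_simps)
  then have "(\<Sum>i = 1..int n. affine_curvature P i) - 2 * m * n + m\<^sup>2 * area2 = 0"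
    unfolding sum_normal_combination[symmetric] by (simp add: plane_det_simps(1))
  then have "m * (m * area2 - n) = 0"
    by (simp add: assms algebra_simps power2_eq_square)
  \<comment> \<open>With m = 0 all normals agree, and \<open>plane_det (side P 0) (side P i)\<close>
    would grow by 1 at each step, against periodicity.\<close>
  moreover have "m \<noteq> 0"
  proof
    assume "m = 0"
    then have "affine_normal P (i + 1) = affine_normal P i" for i
      by (simp add: normal_Suc assms)
    then have const: "affine_normal P i = affine_normal P 0" for i
      using periodic_add_mult[of "affine_normal P" 1 0 i] by simp
    have "plane_det (side P 0) (affine_normal P i) = 1" for i
      unfolding const[of i] by (rule normal_det)
    then have "plane_det (side P 0) (side P (i + 1)) - plane_det (side P 0) (side P i) = 1" for i
      unfolding affine_normal_def by (metis add_diff_cancel_right' plane_det_simps(7))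
    then have "(\<Sum>i = 1..int n. plane_det (side P 0) (side P (i + 1)) - plane_det (side P 0) (side P i)) = n"
      by simp
    moreover have "(\<Sum>i = 1..int n. plane_det (side P 0) (side P (i + 1))) =
        (\<Sum>i = 1..int n. plane_det (side P 0) (side P i))"
      by (rule sum_periodic_shift) (simp add: side_periodic)
    ultimately show False using n3 by (simp add: sum_subtractf)
  qed
  ultimately have "m = n / area2" using area2_pos by (simp add: field_simps)
  then show ?thesis by (simp add: assms power2_eq_square)
qed

text \<open>The recursion \<open>side_Suc\<close> passes to the regular polygon because
  \<open>M\<close> is injective. Its inner product with \<open>side Q i\<close> expresses the
  curvature by the side length and the angle, which do not depend on i.\<close>

lemma affinely_regular_imp_constant:
  assumes "affinely_regular n P"
  obtains m where "\<And>i. affine_curvature P i = m"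
proof -
  obtain Q M b where Q: "convex_regular_polygon n Q" and M: "invertible (M :: real^2^2)"
    and P: "\<And>i. P i = M *v Q i + b"
    using assms unfolding affinely_regular_def by blast
  have side: "side P i = M *v side Q i" for i
    by (simp add: side_def P matrix_vector_mult_diff_distrib)
  obtain r where r: "\<And>i. norm (side Q i) = r"
    using Q unfolding convex_regular_polygon_def by metis
  have "side Q 0 \<noteq> 0" using side_nonzero[of 0] by (auto simp: side)
  then have r0: "r > 0" using r[of 0] by auto
  \<comment> \<open>The cosine of the interior angle at vertex i; the minus sign comes from
    reversing the incoming side.\<close>
  let ?c = "\<lambda>i. - (side Q (i - 1) \<bullet> side Q i) / r\<^sup>2"
  have angle: "interior_angle Q i = arccos (?c i)" for i
  proof -
    have "Q (i - 1) - Q i = - side Q (i - 1)" by (simp add: side_def)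
    moreover have "Q (i + 1) - Q i = side Q i" by (simp add: side_def)
    ultimately show ?thesis unfolding interior_angle_def by (simp add: r power2_eq_square)
  qed
  have bound: "\<bar>?c i\<bar> \<le> 1" for i
    using Cauchy_Schwarz_ineq2[of "side Q (i - 1)" "side Q i"] r0
    by (simp add: r power2_eq_square abs_divide)
  have c: "?c i = ?c 0" for i
  proof -
    have "arccos (?c i) = arccos (?c 0)"
      using Q angle unfolding convex_regular_polygon_def by metis
    then show ?thesis using bound arccos_eq_iff by blast
  qed
  have "affine_curvature P i = 2 + 2 * ?c 0" for i
  proof -
    have "M *v side Q (i + 1) = M *v ((2 - affine_curvature P i) *\<^sub>R side Q i - side Q (i - 1))"
      using side_Suc[of i] unfolding side
      by (simp add: matrix_vector_mult_diff_distrib matrix_vector_mult_scaleR)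
    then have "side Q (i + 1) = (2 - affine_curvature P i) *\<^sub>R side Q i - side Q (i - 1)"
      using M inj_matrix_vector_mult by (metis injD)
    then have "side Q i \<bullet> side Q (i + 1) =
        (2 - affine_curvature P i) * r\<^sup>2 - side Q (i - 1) \<bullet> side Q i"
      using r[of i] by (simp add: inner_diff_right inner_commute power2_norm_eq_inner[symmetric])
    moreover have "side Q i \<bullet> side Q (i + 1) = - ?c 0 * r\<^sup>2" "side Q (i - 1) \<bullet> side Q i = - ?c 0 * r\<^sup>2"
      using c[of i] c[of "i + 1"] r0 by (simp_all add: field_simps)
    ultimately have "r\<^sup>2 * (2 - affine_curvature P i + 2 * ?c 0) = 0"
      by algebra
    then show ?thesis using r0 by simp
  qed
  then show thesis by (rule that)
qed

text \<open>With constant curvature the sides solve \<open>v (i + 1) = c v i - v (i - 1)\<close>. Unless \<open>\<bar>c\<bar> < 2\<close>,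
  a solution vanishing at 0 grows and is not periodic.\<close>

lemma constant_curvature_bound:
  assumes "\<And>i. affine_curvature P i = m"
  shows "\<bar>2 - m\<bar> < 2"
proof (rule ccontr)
  assume big: "\<not> ?thesis"
  let ?x = "\<lambda>i::nat. plane_det (side P 0) (side P (int i))"
  have rec: "?x (Suc (Suc i)) = (2 - m) * ?x (Suc i) - ?x i" for i
    using side_Suc[of "int i + 1"] by (simp add: assms plane_det_simps add.commute)
  \<comment> \<open>The recursion makes the absolute values convex in i, and they start with 0 and
    1.\<close>
  have growth: "\<bar>?x (Suc i)\<bar> \<ge> \<bar>?x i\<bar> + 1" for i
  proof (induction i)
    case 0
    then show ?case using side_det[of 0] by (simp add: plane_det_simps)
  next
    case (Suc i)
    have "2 * \<bar>?x (Suc i)\<bar> \<le> \<bar>2 - m\<bar> * \<bar>?x (Suc i)\<bar>"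
      using big by (intro mult_right_mono) auto
    also have "\<dots> = \<bar>?x (Suc (Suc i)) + ?x i\<bar>"
      unfolding rec by (simp add: abs_mult)
    also have "\<dots> \<le> \<bar>?x (Suc (Suc i))\<bar> + \<bar>?x i\<bar>"
      by (rule abs_triangle_ineq)
    finally show ?case using Suc.IH by linarith
  qed
  have "\<bar>?x i\<bar> \<ge> real i" for i
  proof (induction i)
    case (Suc i)
    then show ?case using growth[of i] by simp
  qed simp
  \<comment> \<open>By periodicity side n is side 0, where the determinant is 0.\<close>
  from this[of n] show False
    using side_periodic[of 0] n3 by (simp add: plane_det_simps)
qed

text \<open>The linear map sending the first two sides to unit vectors at the angle \<open>\<theta>\<close> with
  \<open>2 cos \<theta> = 2 - m\<close> turns the recursion of the sides into the rotation by \<open>\<theta>\<close>.\<close>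

lemma constant_curvature_imp_affinely_regular:
  assumes "\<And>i. affine_curvature P i = m"
  shows "affinely_regular n P"
proof -
  define c d where "c = (2 - m) / 2" and "d = sqrt (1 - c\<^sup>2)"
  have "\<bar>c\<bar> < 1" using constant_curvature_bound[OF assms] by (simp add: c_def)
  then have "c\<^sup>2 < 1" by (simp add: abs_square_less_1)
  then have d: "d > 0" "d\<^sup>2 = 1 - c\<^sup>2" by (simp_all add: d_def)
  let ?v = "side P 0" and ?w = "side P 1"
  \<comment> \<open>With c and d the cosine and sine of \<theta>, this matrix maps \<open>?v\<close>
    to (1, 0) and \<open>?w\<close> to (c, d).\<close>
  define N :: "real^2^2" where
    "N = vector [vector [?w $ 2 - c * ?v $ 2, c * ?v $ 1 - ?w $ 1], vector [- d * ?v $ 2, d * ?v $ 1]]"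
  have vw: "plane_det ?v ?w = 1" using side_det[of 0] by simp
  have N: "(N *v x) $ 1 = plane_det x ?w + c * plane_det ?v x" "(N *v x) $ 2 = d * plane_det ?v x" for x
    by (simp_all add: N_def matrix_vector_mult_def sum_2 plane_det_eq algebra_simps)
  have "det N = d * plane_det ?v ?w"
    by (simp add: N_def det_2 plane_det_eq algebra_simps)
  then have "invertible N" using d vw by (simp add: invertible_det_nz)
  then obtain M where M: "N ** M = mat 1" "M ** N = mat 1"
    unfolding invertible_def by blast
  have MN: "M *v (N *v x) = x" "N *v (M *v x) = x" for x
    by (simp_all add: M matrix_vector_mul_assoc)
  define Q where "Q = (\<lambda>x. N *v x) \<circ> P"
  have sQ: "side Q i = N *v side P i" for i
    by (simp add: Q_def side_def matrix_vector_mult_diff_distrib)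
  have rec: "side Q (i + 1) = (2 * c) *\<^sub>R side Q i - side Q (i - 1)" for i
    using side_Suc[of i] unfolding sQ assms
    by (simp add: c_def matrix_vector_mult_diff_distrib matrix_vector_mult_scaleR)
  have inv_rec: "side Q (i - 1) = (2 * c) *\<^sub>R side Q i - side Q (i + 1)" for i
    using rec[of i] by simp
  \<comment> \<open>The Gram matrix of two consecutive sides is preserved by the recursion in both
    directions, which is where the coefficient \<open>2 * c\<close> must match the inner product
    c.\<close>
  have metric: "side Q i \<bullet> side Q i = 1 \<and> side Q i \<bullet> side Q (i + 1) = c \<and> side Q (i + 1) \<bullet> side Q (i + 1) = 1" for i
  proof (induction i rule: int_induct[where k = 0])
    case base
    show ?case
      using vw d(2) by (simp add: sQ inner_vec_def sum_2 N plane_det_simps power2_eq_square)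
  next
    case (step1 i)
    then show ?case
      using rec[of "i + 1"] by (simp add: inner_diff_left inner_diff_right inner_commute)
  next
    case (step2 i)
    then show ?case
      using inv_rec[of i] by (simp add: inner_diff_left inner_diff_right inner_commute)
  qed
  then have norm: "norm (side Q i) = 1" for i by (simp add: norm_eq_1)
  have "interior_angle Q i = arccos (- c)" for i
  proof -
    have 1: "Q (i - 1) - Q i = - side Q (i - 1)" by (simp add: side_def)
    have 2: "Q (i + 1) - Q i = side Q i" by (simp add: side_def)
    show ?thesis unfolding interior_angle_def 1 2 using metric[of "i - 1"] by (simp add: norm)
  qed
  moreover have "convex_polygon n Q"
    unfolding Q_def
    by (rule convex_polygon_linear_image[OF _ _ _ _ equal_area_convex, where g = "\<lambda>x. M *v x"]) (simp_all add: MN)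
  ultimately have "convex_regular_polygon n Q"
    by (simp add: convex_regular_polygon_def norm)
  moreover have "invertible M"
    unfolding invertible_def using M by blast
  moreover have "P i = M *v Q i + 0" for i by (simp add: Q_def MN)
  ultimately show ?thesis unfolding affinely_regular_def by blast
qed

end

theorem theorem6p1:
  fixes n :: nat and P :: "int \<Rightarrow> real^2" and A L :: real
  assumes "n \<ge> 5"
    and "convex_equal_area_polygon n P"
    and "affine_normalized P"
    and "A = measure lebesgue (polygon_region n P)"
    and "L = real n"
  shows "(\<Sum>i = 1..int n. affine_curvature P i) \<le> L\<^sup>2 / (2 * A) \<and>
         ((\<Sum>i = 1..int n. affine_curvature P i) = L\<^sup>2 / (2 * A) \<longleftrightarrow> affinely_regular n P)"
proof -
  have n3: "n \<ge> 3" using assms(1) by simp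
  note facts = n3 assms(2,3)
  show ?thesis
    unfolding assms(4,5)
    using curvature_sum_le[OF facts] curvature_sum_constant[OF facts]
      affinely_regular_imp_constant[OF facts] constant_curvature_imp_affinely_regular[OF facts]
    by (metis of_nat_power)
qed

end
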